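(* For every integer $n$ with $2 \le n \le 8$, $\Gamma(G_n) = 2n-1$.
   Context: For a finite simple graph $G$ and $k \in \mathbb{N}$, a $k$-complete coloring of $G$ is a map $c: V(G) \to [k] = \{1,\dots,k\}$ such that for every pair of distinct colors $i \ne j$ in $[k]$ there is an edge $\{u,v\} \in E(G)$ with $c(u)=i$ and $c(v)=j$ (adjacent vertices may receive the same color). The complete coloring number $\Gamma(G)$ is the largest $k$ for which a $k$-complete coloring of $G$ exists. $G_n$ denotes the $n \times n$ square grid graph: vertices $(i,j) \in \mathbb{Z}^2$ with $1 \le i,j \le n$, and $(i_1,j_1) \sim (i_2,j_2)$ iff $|i_1-i_2|+|j_1-j_2| = 1$. *)

theory Defs
  imports "Graph_Theory.Pair_Digraph"
begin

text \<open>A finite simple graph is a digraph satisfying \<^locale>\<open>pair_graph\<close>: its arc set is finite,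
  irreflexive and symmetric, so an edge between \<open>u\<close> and \<open>v\<close> is the pair of
  arcs \<open>(u, v)\<close> and \<open>(v, u)\<close>.\<close>

definition complete_coloring :: "'a pair_pre_digraph \<Rightarrow> nat \<Rightarrow> ('a \<Rightarrow> nat) \<Rightarrow> bool" where
  "complete_coloring G k c \<longleftrightarrow>
     (\<forall>v \<in> pverts G. c v \<in> {1..k}) \<and>
     (\<forall>i \<in> {1..k}. \<forall>j \<in> {1..k}. i \<noteq> j \<longrightarrow> (\<exists>(u, v) \<in> parcs G. c u = i \<and> c v = j))"

definition complete_coloring_number :: "'a pair_pre_digraph \<Rightarrow> nat" where
  "complete_coloring_number G = (GREATEST k. \<exists>c. complete_coloring G k c)"

definition grid_graph :: "nat \<Rightarrow> (int \<times> int) pair_pre_digraph" where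
  "grid_graph n =
     (let V = {1..int n} \<times> {1..int n}
      in \<lparr>pverts = V,
          parcs = {((i1, j1), (i2, j2)).
                     (i1, j1) \<in> V \<and> (i2, j2) \<in> V \<and> \<bar>i1 - i2\<bar> + \<bar>j1 - j2\<bar> = 1}\<rparr>)"

lemma pair_graph_grid_graph: "pair_graph (grid_graph n)"
proof
  have "parcs (grid_graph n) \<subseteq> pverts (grid_graph n) \<times> pverts (grid_graph n)"
    by (auto simp: grid_graph_def Let_def)
  moreover show "finite (pverts (grid_graph n))"
    by (simp add: grid_graph_def Let_def)
  ultimately show "finite (parcs (grid_graph n))"
    by (meson finite_SigmaI finite_subset)
qed (auto simp: grid_graph_def Let_def symmetric_def sym_def)

text \<open>On finite graphs the number of colors is bounded, so that the greatest \<open>k\<close> exists.\<close>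

lemma complete_coloring_le:
  assumes "finite (parcs G)" and "complete_coloring G k c"
  shows "k \<le> Suc (card (parcs G))"
proof (cases "k = 0")
  case False
  have "{1} \<times> {2..k} \<subseteq> (\<lambda>(u, v). (c u, c v)) ` parcs G"
  proof
    fix x :: "nat \<times> nat" assume "x \<in> {1::nat} \<times> {2..k}"
    then obtain j where j: "x = (1, j)" "j \<in> {1..k}" "1 \<noteq> j" by auto
    have "(1::nat) \<in> {1..k}" using False by simp
    with j assms(2) obtain u v where "(u, v) \<in> parcs G" "c u = 1" "c v = j"
      unfolding complete_coloring_def by blast
    with j(1) show "x \<in> (\<lambda>(u, v). (c u, c v)) ` parcs G" by force
  qed
  hence "card ({1::nat} \<times> {2..k}) \<le> card (parcs G)"
    using surj_card_le[OF assms(1)] by blast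
  thus ?thesis by simp
qed simp

lemma
  assumes "pair_graph G"
  shows complete_coloring_number_attained:
      "\<exists>c. complete_coloring G (complete_coloring_number G) c"
    and complete_coloring_number_upper:
      "complete_coloring G k c \<Longrightarrow> k \<le> complete_coloring_number G"
proof -
  interpret pair_graph G by fact
  let ?P = "\<lambda>k. \<exists>c. complete_coloring G k c"
  have bound: "\<forall>k. ?P k \<longrightarrow> k \<le> Suc (card (parcs G))"
    using complete_coloring_le pair_finite_arcs by blast
  have "complete_coloring G 1 (\<lambda>_. 1)"
    by (simp add: complete_coloring_def)
  hence "?P 1" by blast
  from GreatestI_nat[of ?P, OF this] bound
  show "?P (complete_coloring_number G)"
    unfolding complete_coloring_number_def by blast
  show "complete_coloring G k c \<Longrightarrow> k \<le> complete_coloring_number G"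
    using Greatest_le_nat[of ?P k] bound unfolding complete_coloring_number_def by blast
qed

end

theory Submission
  imports Defs
begin

text \<open>For \<open>k\<close> colors every one of the \<open>k (k - 1)\<close> ordered pairs of distinct colors needs its own
  arc, and the grid has only \<open>4 n (n - 1) < 2 n (2 n - 1)\<close> arcs, so \<open>k < 2 n\<close>. For the lower bound
  only \<open>n - 1\<close> edges may be wasted; the explicit colorings below were found by simulated annealing,
  minimizing the number of missing color pairs.\<close>

lemma complete_coloring_pairs_le_card_arcs:
  assumes "finite (parcs G)" and "complete_coloring G k c"
  shows "k * (k - 1) \<le> card (parcs G)"
proof -
  let ?D = "{1..k} \<times> {1..k} - Id_on {1..k}"
  have "?D \<subseteq> (\<lambda>(u, v). (c u, c v)) ` parcs G"
  proof
    fix x assume "x \<in> ?D"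
    then obtain i j where ij: "x = (i, j)" "i \<in> {1..k}" "j \<in> {1..k}" "i \<noteq> j"
      by (cases x) (auto simp: Id_on_iff)
    with assms(2) obtain u v where "(u, v) \<in> parcs G" "c u = i" "c v = j"
      unfolding complete_coloring_def by blast
    with ij(1) show "x \<in> (\<lambda>(u, v). (c u, c v)) ` parcs G" by force
  qed
  with assms(1) have "card ?D \<le> card (parcs G)"
    using surj_card_le by blast
  moreover have "card ?D = k * k - k"
  proof -
    have "Id_on {1..k} = (\<lambda>i. (i, i)) ` {1..k}" by auto
    then have "card (Id_on {1..k}) = k"
      by (simp add: card_image inj_on_def)
    moreover have "Id_on {1..k} \<subseteq> {1..k} \<times> {1..k}" by auto
    ultimately show ?thesis
      using finite_subset by (subst card_Diff_subset) auto
  qed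
  ultimately show ?thesis by (simp add: diff_mult_distrib2)
qed

text \<open>Every arc or its reverse increases one coordinate by 1, and for each coordinate there
  are at most \<open>n * (n - 1)\<close> increasing arcs. Since only an upper bound is wanted,
  images and unions are estimated without checking injectivity or disjointness.\<close>

lemma card_arcs_grid_graph_le: "card (parcs (grid_graph n)) \<le> 4 * (n * (n - 1))"
proof -
  let ?R = "{1..int n} \<times> {1..int n - 1}"
  \<comment> \<open>\<open>?v\<close> takes its arguments swapped, so that \<open>?R\<close>, whose
    second component stops at \<open>n - 1\<close>, indexes both directions.\<close>
  let ?h = "\<lambda>(i, j). ((i, j), (i, j + 1))" and ?v = "\<lambda>(j, i). ((i, j), (i + 1, j))"
  let ?E = "?h ` ?R \<union> ?v ` ?R"
  have "parcs (grid_graph n) \<subseteq> ?E \<union> ?E\<inverse>"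
  proof
    fix x assume "x \<in> parcs (grid_graph n)"
    then obtain i1 j1 i2 j2 where x: "x = ((i1, j1), (i2, j2))"
      and bounds: "i1 \<in> {1..int n}" "j1 \<in> {1..int n}" "i2 \<in> {1..int n}" "j2 \<in> {1..int n}"
      and "\<bar>i1 - i2\<bar> + \<bar>j1 - j2\<bar> = 1"
      by (auto simp: grid_graph_def Let_def)
    then consider "i2 = i1" "j2 = j1 + 1" | "i2 = i1" "j1 = j2 + 1"
      | "j2 = j1" "i2 = i1 + 1" | "j2 = j1" "i1 = i2 + 1"
      by linarith
    then show "x \<in> ?E \<union> ?E\<inverse>"
      by cases (use bounds in \<open>auto simp: x image_iff\<close>)
  qed
  then have "card (parcs (grid_graph n)) \<le> card (?E \<union> ?E\<inverse>)"
    by (intro card_mono) auto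
  also have "\<dots> \<le> card ?E + card ?E"
    by (rule order_trans[OF card_Un_le]) (simp add: card_inverse)
  also have "card ?E \<le> card ?R + card ?R"
    by (intro order_trans[OF card_Un_le] add_mono card_image_le) auto
  also have "card ?R = n * (n - 1)"
    by (simp add: nat_diff_distrib')
  finally show ?thesis by simp
qed

lemma complete_coloring_grid_graph_less:
  assumes "0 < n" and "complete_coloring (grid_graph n) k c"
  shows "k < 2 * n"
proof (rule ccontr)
  interpret pair_graph "grid_graph n" by (rule pair_graph_grid_graph)
  assume "\<not> k < 2 * n"
  then have "2 * n * (2 * n - 1) \<le> k * (k - 1)"
    by (intro mult_le_mono) auto
  also have "\<dots> \<le> 4 * (n * (n - 1))"
    using complete_coloring_pairs_le_card_arcs[OF pair_finite_arcs assms(2)]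
      card_arcs_grid_graph_le by (rule order_trans)
  \<comment> \<open>The positive factor \<open>2 * n\<close> cancels. Positivity matters once more
    below: for \<open>n = 0\<close> truncated subtraction would make both sides 0.\<close>
  finally have "2 * n - 1 \<le> 2 * (n - 1)" using assms(1) by simp
  with assms(1) show False by linarith
qed

definition adjacent_entries :: "'a list list \<Rightarrow> ('a \<times> 'a) list" where
  "adjacent_entries xss =
     concat (map (\<lambda>xs. zip xs (tl xs)) xss) @ concat (map (\<lambda>(xs, ys). zip xs ys) (zip xss (tl xss)))"

text \<open>An executable certificate check. \<open>adjacent_entries\<close> lists each grid edge in
  only one direction, so a color pair \<open>i < j\<close> is looked up in both orders.\<close>

definition complete_grid :: "nat \<Rightarrow> nat \<Rightarrow> nat list list \<Rightarrow> bool" where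
  "complete_grid n k xss \<longleftrightarrow>
     length xss = n \<and> list_all (\<lambda>xs. length xs = n \<and> list_all (\<lambda>x. 1 \<le> x \<and> x \<le> k) xs) xss \<and>
     (let ps = adjacent_entries xss in
      list_all (\<lambda>j. list_all (\<lambda>i. List.member ps (i, j) \<or> List.member ps (j, i)) [1..<j]) [1..<Suc k])"

lemma adjacent_entriesE [consumes 3, case_names row column]:
  assumes "(x, y) \<in> set (adjacent_entries xss)"
    and "length xss = n" and "\<forall>xs \<in> set xss. length xs = n"
  obtains i j where "i < n" "Suc j < n" "xss ! i ! j = x" "xss ! i ! Suc j = y"
    | i j where "Suc i < n" "j < n" "xss ! i ! j = x" "xss ! Suc i ! j = y"
proof -
  consider (row) xs where "xs \<in> set xss" "(x, y) \<in> set (zip xs (tl xs))"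
    | (column) xs ys where "(xs, ys) \<in> set (zip xss (tl xss))" "(x, y) \<in> set (zip xs ys)"
    using assms(1) by (auto simp: adjacent_entries_def)
  then show thesis
  proof cases
    case row
    then obtain i where "i < n" "xs = xss ! i" using assms(2) by (auto simp: in_set_conv_nth)
    \<comment> \<open>Entry \<open>j\<close> of \<open>tl xs\<close> is entry \<open>Suc j\<close>
      of \<open>xs\<close>, and the zip ends with the shorter list \<open>tl xs\<close>; this gives
      \<open>Suc j < n\<close>.\<close>
    with row assms(3) that(1)[of i] show thesis
      by (auto simp: in_set_zip nth_tl less_diff_conv)
  next
    case column
    then obtain i where i: "Suc i < n" "xs = xss ! i" "ys = xss ! Suc i"
      using assms(2) by (auto simp: in_set_zip nth_tl less_diff_conv)
    with assms have "length xs = n" "length ys = n" by auto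
    with column i that(2)[of i] show thesis by (auto simp: in_set_zip)
  qed
qed

lemma complete_grid_imp_complete_coloring:
  assumes "complete_grid n k xss"
  shows "complete_coloring (grid_graph n) k (\<lambda>(i, j). xss ! nat (i - 1) ! nat (j - 1))"
    (is "complete_coloring _ _ ?c")
proof -
  have len: "length xss = n" "\<forall>xs \<in> set xss. length xs = n"
    and range: "\<And>xs x. xs \<in> set xss \<Longrightarrow> x \<in> set xs \<Longrightarrow> x \<in> {1..k}"
    and pairs: "\<And>i j. 1 \<le> i \<Longrightarrow> i < j \<Longrightarrow> j \<le> k \<Longrightarrow>
      (i, j) \<in> set (adjacent_entries xss) \<or> (j, i) \<in> set (adjacent_entries xss)"
    using assms by (auto simp: complete_grid_def list_all_iff Let_def simp del: upt_Suc)
  interpret pair_graph "grid_graph n" by (rule pair_graph_grid_graph)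
  have realized: "\<exists>(u, v) \<in> parcs (grid_graph n). ?c u = x \<and> ?c v = y"
    if "(x, y) \<in> set (adjacent_entries xss)" for x y
    using that len
  proof (cases rule: adjacent_entriesE)
    case (row i j)
    then show ?thesis
      \<comment> \<open>List indices start at 0 and grid coordinates at 1, so entry
        \<open>(i, j)\<close> sits at vertex \<open>(i + 1, j + 1)\<close>.\<close>
      by (intro bexI[of _ "((int i + 1, int j + 1), (int i + 1, int j + 2))"])
        (auto simp: grid_graph_def Let_def nat_add_distrib)
  next
    case (column i j)
    then show ?thesis
      by (intro bexI[of _ "((int i + 1, int j + 1), (int i + 2, int j + 1))"])
        (auto simp: grid_graph_def Let_def nat_add_distrib)
  qed
  \<comment> \<open>The arc found above has the orientation of the list; symmetry of the grid
    supplies the opposite one.\<close>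
  have sym: "\<exists>(u, v) \<in> parcs (grid_graph n). ?c u = y \<and> ?c v = x"
    if "\<exists>(u, v) \<in> parcs (grid_graph n). ?c u = x \<and> ?c v = y" for x y
    using that arcs_symmetric by fast
  have "\<exists>(u, v) \<in> parcs (grid_graph n). ?c u = x \<and> ?c v = y"
    if "x \<in> {1..k}" "y \<in> {1..k}" "x \<noteq> y" for x y
    using that pairs[of x y] pairs[of y x] realized sym
    by (metis atLeastAtMost_iff linorder_neqE_nat)
  moreover have "?c v \<in> {1..k}" if vert: "v \<in> pverts (grid_graph n)" for v
  proof -
    obtain i j where v: "v = (i, j)" "i \<in> {1..int n}" "j \<in> {1..int n}"
      using vert by (cases v) (auto simp: grid_graph_def Let_def)
    then have "xss ! nat (i - 1) \<in> set xss" using len by (intro nth_mem) auto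
    moreover from this have "xss ! nat (i - 1) ! nat (j - 1) \<in> set (xss ! nat (i - 1))"
      using len v by (intro nth_mem) auto
    ultimately show ?thesis using range v by auto
  qed
  ultimately show ?thesis unfolding complete_coloring_def by blast
qed

text \<open>The two vertically adjacent 1s form the single wasted edge. This table and the following
  ones are checked by rewriting, so the kernel verifies each evaluation.\<close>

lemma complete_grid_2: "complete_grid 2 3
  [[1, 3],
   [1, 2]]"
  by code_simp

lemma complete_grid_3: "complete_grid 3 5
  [[2, 5, 3],
   [1, 4, 2],
   [5, 3, 1]]"
  by code_simp

lemma complete_grid_4: "complete_grid 4 7
  [[7, 4, 2, 1],
   [2, 3, 6, 7],
   [5, 4, 1, 3],
   [3, 6, 5, 7]]"
  by code_simp

lemma complete_grid_5: "complete_grid 5 9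
  [[7, 8, 9, 5, 3],
   [3, 5, 4, 7, 2],
   [9, 6, 8, 1, 9],
   [2, 4, 3, 6, 7],
   [5, 1, 1, 2, 8]]"
  by code_simp

lemma complete_grid_6: "complete_grid 6 11
  [[7, 9, 5, 3, 7, 4],
   [11, 4, 1, 9, 10, 2],
   [1, 10, 3, 2, 8, 6],
   [7, 5, 8, 11, 9, 6],
   [6, 3, 4, 5, 2, 7],
   [10, 11, 6, 6, 1, 8]]"
  by code_simp

lemma complete_grid_7: "complete_grid 7 13
  [[5, 6, 1, 5, 8, 5, 11],
   [3, 7, 2, 10, 7, 13, 9],
   [12, 5, 9, 4, 11, 8, 6],
   [8, 4, 7, 1, 13, 10, 9],
   [2, 13, 12, 10, 6, 3, 12],
   [5, 3, 1, 11, 12, 4, 2],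
   [1, 9, 8, 3, 2, 6, 11]]"
  by code_simp

text \<open>Here 112 edges realize 105 color pairs, leaving 7 edges to spare.\<close>

lemma complete_grid_8: "complete_grid 8 15
  [[14, 2, 7, 4, 8, 13, 6, 14],
   [8, 6, 9, 14, 1, 4, 15, 12],
   [12, 5, 4, 10, 15, 3, 2, 9],
   [1, 9, 1, 11, 13, 5, 10, 8],
   [10, 13, 2, 4, 12, 11, 7, 15],
   [11, 3, 12, 6, 7, 1, 3, 5],
   [15, 9, 10, 3, 14, 5, 8, 2],
   [14, 11, 6, 1, 13, 7, 8, 11]]"
  by code_simp

theorem theorem1:
  fixes n :: nat
  assumes "2 \<le> n" and "n \<le> 8"
  shows "complete_coloring_number (grid_graph n) = 2 * n - 1"
proof (rule antisym)
  from assms consider "n = 2" | "n = 3" | "n = 4" | "n = 5" | "n = 6" | "n = 7" | "n = 8"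
    by linarith
  then have "\<exists>xss. complete_grid n (2 * n - 1) xss"
    by cases (use complete_grid_2 complete_grid_3 complete_grid_4 complete_grid_5
      complete_grid_6 complete_grid_7 complete_grid_8 in auto)
  then show "2 * n - 1 \<le> complete_coloring_number (grid_graph n)"
    using complete_grid_imp_complete_coloring
      complete_coloring_number_upper[OF pair_graph_grid_graph] by blast
  \<comment> \<open>The maximum is itself attained by a coloring, so the strict bound applies to
    it.\<close>
  have "complete_coloring_number (grid_graph n) < 2 * n"
    using complete_coloring_number_attained[OF pair_graph_grid_graph, of n] assms(1)
      complete_coloring_grid_graph_less[of n] by auto
  then show "complete_coloring_number (grid_graph n) \<le> 2 * n - 1" by simp
qed

end
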